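(* For every integer $n\ge 0$, there is a bijection between the set of permutations in $\mathcal{S}_{n+1}$ that avoid the partially ordered generalized pattern $3$-$12$-$3$ and the set of bicolored set partitions of $[n]$.
   Context: $[n]=\{1,\dots,n\}$; $\mathcal{S}_n$ is the set of permutations of $[n]$, written as words $a_1a_2\dots a_n$. A partially ordered generalized pattern is a word $p_1p_2\dots p_m$ of positive integers (repetitions allowed) with a dash written between some of the consecutive letters. An occurrence of it in a permutation $\pi=a_1\dots a_n$ is a subsequence $a_{k_1}a_{k_2}\dots a_{k_m}$ with $k_1<k_2<\dots<k_m$ such that (a) $p_i>p_j$ implies $a_{k_i}>a_{k_j}$ for all $i,j$ (no condition is imposed when $p_i=p_j$), and (b) $k_{i+1}=k_i+1$ whenever $p_i$ and $p_{i+1}$ are not separated by a dash. $\pi$ avoids the pattern if it has no occurrence of it. Thus an occurrence of $3$-$12$-$3$ consists of four elements $c,a,b,d$ appearing in this order, with $a,b$ adjacent, $a<b$, and $b<c$, $b<d$. A bicolored set partition of a set $S$ is a partition of $S$ into nonempty disjoint blocks together with an assignment of one of two fixed colors to each block. *)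

theory Defs
  imports "HOL-Combinatorics.Multiset_Permutations" "HOL-Library.FuncSet" "HOL-Library.Disjoint_Sets"
begin

text \<open>
  A partially ordered generalized pattern is a pair of its word of letters and the set of
  (0-based) positions \<open>i\<close> such that a dash separates letter \<open>i\<close> from letter \<open>i + 1\<close>.
\<close>

type_synonym pogp = "nat list \<times> nat set"

text \<open>
  The list \<open>ks\<close> holds the (0-based) positions in the word \<open>xs\<close> of the letters of the occurrence.
\<close>

definition pogp_occurrence :: "pogp \<Rightarrow> nat list \<Rightarrow> nat list \<Rightarrow> bool" where
  "pogp_occurrence = (\<lambda>(p, D) xs ks.
     length ks = length p \<and> sorted_wrt (<) ks \<and> (\<forall>k\<in>set ks. k < length xs) \<and>
     (\<forall>i<length p. \<forall>j<length p. p ! i > p ! j \<longrightarrow> xs ! (ks ! i) > xs ! (ks ! j)) \<and>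
     (\<forall>i. Suc i < length p \<and> i \<notin> D \<longrightarrow> ks ! Suc i = Suc (ks ! i)))"

definition avoids_pogp :: "nat list \<Rightarrow> pogp \<Rightarrow> bool" where
  "avoids_pogp xs P \<longleftrightarrow> \<not> (\<exists>ks. pogp_occurrence P xs ks)"

definition pattern_3_12_3 :: pogp where
  "pattern_3_12_3 = ([3, 1, 2, 3], {0, 2})"

text \<open>
  The two colors are the two Booleans. A coloring is extensional, so that it is determined by its
  values on the blocks.
\<close>

definition bicolored_set_partitions :: "'a set \<Rightarrow> ('a set set \<times> ('a set \<Rightarrow> bool)) set" where
  "bicolored_set_partitions A = {(P, c). partition_on A P \<and> c \<in> P \<rightarrow>\<^sub>E (UNIV :: bool set)}"

end

theory Submission
  imports Defs
begin

text \<open>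
  Split a permutation as \<open>xs @ m # ys\<close> at its maximum \<open>m\<close>. As \<open>m\<close> can serve as the last letter of an
  occurrence for each ascent in \<open>xs\<close>, and as the first letter for each ascent in \<open>ys\<close>, the
  permutation avoids 3-12-3 iff \<open>xs\<close> avoids 3-12 and \<open>ys\<close> avoids 12-3. Splitting again at the
  maximum, a permutation \<open>xs @ m # ys\<close> avoids 12-3 iff \<open>xs\<close> is decreasing and \<open>ys\<close> avoids 12-3
  (and symmetrically for 3-12), so the avoiders of either pattern obey the recursion of set
  partitions that removes the block of the maximum. Hence the avoiders of 3-12-3 are counted by the
  triples of a subset, a partition of it, and a partition of its complement, which are the
  bicolored partitions.
\<close>

section \<open>Adjacent pairs of letters in a word\<close>

text \<open>The predicate also sees the prefix and suffix around the pair, so that conditions on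
  earlier or later letters become instances and one splitting rule serves all three
  patterns.\<close>

definition all_adjacent :: "('a list \<Rightarrow> 'a \<Rightarrow> 'a \<Rightarrow> 'a list \<Rightarrow> bool) \<Rightarrow> 'a list \<Rightarrow> bool" where
  "all_adjacent P zs \<longleftrightarrow> (\<forall>us a b vs. zs = us @ a # b # vs \<longrightarrow> P us a b vs)"

text \<open>The pair \<open>a\<close>, \<open>b\<close> lies left of \<open>m\<close>, ends in
  \<open>m\<close>, starts with \<open>m\<close>, or lies right of \<open>m\<close>; these are the
  four disjuncts.\<close>

lemma append_Cons_eq_adjacent_iff:
  "xs @ m # ys = us @ a # b # vs \<longleftrightarrow>
     (\<exists>vs'. xs = us @ a # b # vs' \<and> vs = vs' @ m # ys) \<or>
     (xs = us @ [a] \<and> b = m \<and> vs = ys) \<or>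
     (us = xs \<and> a = m \<and> ys = b # vs) \<or>
     (\<exists>us'. us = xs @ m # us' \<and> ys = us' @ a # b # vs)"
  by (auto simp: append_eq_append_conv2 Cons_eq_append_conv append_eq_Cons_conv)

lemma all_adjacent_append_Cons:
  "all_adjacent P (xs @ m # ys) \<longleftrightarrow>
     all_adjacent (\<lambda>us a b vs. P us a b (vs @ m # ys)) xs \<and>
     (\<forall>us a. xs = us @ [a] \<longrightarrow> P us a m ys) \<and>
     (\<forall>b vs. ys = b # vs \<longrightarrow> P xs m b vs) \<and>
     all_adjacent (\<lambda>us a b vs. P (xs @ m # us) a b vs) ys"
proof -
  have "all_adjacent P (xs @ m # ys) \<longleftrightarrow>
      (\<forall>us a b vs vs'. xs = us @ a # b # vs' \<and> vs = vs' @ m # ys \<longrightarrow> P us a b vs) \<and>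
      (\<forall>us a b vs. xs = us @ [a] \<and> b = m \<and> vs = ys \<longrightarrow> P us a b vs) \<and>
      (\<forall>us a b vs. us = xs \<and> a = m \<and> ys = b # vs \<longrightarrow> P us a b vs) \<and>
      (\<forall>us a b vs us'. us = xs @ m # us' \<and> ys = us' @ a # b # vs \<longrightarrow> P us a b vs)"
    unfolding all_adjacent_def append_Cons_eq_adjacent_iff imp_disjL all_conj_distrib
      imp_ex ex_simps[symmetric] by simp
  \<comment> \<open>Eliminating \<open>us\<close> by its equation leaves \<open>us'\<close> as the
    innermost variable of the last conjunct; this swap restores the quantifier order of
    \<open>all_adjacent\<close>.\<close>
  moreover have "(\<forall>a b vs us. Q us a b vs) \<longleftrightarrow> (\<forall>us a b vs. Q us a b vs)"
    for Q :: "'a list \<Rightarrow> 'a \<Rightarrow> 'a \<Rightarrow> 'a list \<Rightarrow> bool"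
    by blast
  note this[of "\<lambda>us a b vs. ys = us @ a # b # vs \<longrightarrow> P (xs @ m # us) a b vs"]
  ultimately show ?thesis
    unfolding all_adjacent_def by simp
qed

text \<open>Without ascents each letter is at least its right neighbour, and transitivity of
  \<open>\<ge>\<close> extends this to all pairs.\<close>

lemma all_adjacent_not_less_iff:
  "all_adjacent (\<lambda>us a b vs. \<not> a < b) xs \<longleftrightarrow> sorted_wrt (\<ge>) (xs :: 'a::linorder list)"
proof -
  have "successively (\<ge>) xs \<longleftrightarrow> all_adjacent (\<lambda>us a b vs. \<not> a < b) xs"
  proof (induction xs rule: induct_list012)
    case (3 x y zs)
    have "all_adjacent P [] \<longleftrightarrow> True" for P :: "'a list \<Rightarrow> 'a \<Rightarrow> 'a \<Rightarrow> 'a list \<Rightarrow> bool"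
      by (simp add: all_adjacent_def)
    then have "all_adjacent (\<lambda>us a b vs. \<not> a < b) (x # y # zs) \<longleftrightarrow>
        \<not> x < y \<and> all_adjacent (\<lambda>us a b vs. \<not> a < b) (y # zs)"
      using all_adjacent_append_Cons[of "\<lambda>us a b vs. \<not> a < b" "[]" x "y # zs"] by simp
    with "3.IH"(2) show ?case by (simp add: not_less)
  qed (simp_all add: all_adjacent_def Cons_eq_append_conv)
  moreover have "transp ((\<ge>) :: 'a \<Rightarrow> 'a \<Rightarrow> bool)"
    by (rule transp_on_ge)
  ultimately show ?thesis
    using successively_conv_sorted_wrt by blast
qed

section \<open>Pattern avoidance in terms of ascents\<close>

text \<open>As \<open>a < b\<close>, comparing the outer letters with \<open>b\<close> alone
  suffices; the two equal letters 3 impose no comparison between \<open>c\<close> and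
  \<open>d\<close>.\<close>

definition avoids_3_12_3 :: "'a::linorder list \<Rightarrow> bool" where
  "avoids_3_12_3 = all_adjacent (\<lambda>us a b vs. a < b \<longrightarrow> \<not> ((\<exists>c\<in>set us. b < c) \<and> (\<exists>d\<in>set vs. b < d)))"

definition avoids_12_3 :: "'a::linorder list \<Rightarrow> bool" where
  "avoids_12_3 = all_adjacent (\<lambda>us a b vs. a < b \<longrightarrow> \<not> (\<exists>d\<in>set vs. b < d))"

definition avoids_3_12 :: "'a::linorder list \<Rightarrow> bool" where
  "avoids_3_12 = all_adjacent (\<lambda>us a b vs. a < b \<longrightarrow> \<not> (\<exists>c\<in>set us. b < c))"

lemma pogp_occurrence_3_12_3_iff:
  "pogp_occurrence pattern_3_12_3 xs ks \<longleftrightarrow>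
     (\<exists>i j k. ks = [i, j, Suc j, k] \<and> i < j \<and> Suc j < k \<and> k < length xs \<and>
        xs ! j < xs ! Suc j \<and> xs ! Suc j < xs ! i \<and> xs ! Suc j < xs ! k)"
proof (cases "length ks = 4")
  case True
  then obtain a b c d where ks: "ks = [a, b, c, d]"
    by (auto simp: numeral_eq_Suc length_Suc_conv)
  \<comment> \<open>With dashes after positions 0 and 2, adjacency is demanded only between
    positions 1 and 2.\<close>
  have "Suc i < 4 \<and> i \<noteq> 0 \<and> i \<noteq> 2 \<longleftrightarrow> i = 1" for i :: nat
    by presburger
  then have Suc_less_4: "(\<forall>i. Suc i < 4 \<and> i \<noteq> 0 \<and> i \<noteq> 2 \<longrightarrow> Q i) \<longleftrightarrow> Q 1" for Q :: "nat \<Rightarrow> bool"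
    by simp
  show ?thesis
    by (simp add: pogp_occurrence_def pattern_3_12_3_def ks Suc_less_4 All_less_Suc) (auto simp: numeral_eq_Suc)
qed (auto simp: pogp_occurrence_def pattern_3_12_3_def)

lemma avoids_pogp_3_12_3_iff: "avoids_pogp xs pattern_3_12_3 \<longleftrightarrow> avoids_3_12_3 xs"
proof
  assume *: "avoids_pogp xs pattern_3_12_3"
  show "avoids_3_12_3 xs"
    unfolding avoids_3_12_3_def all_adjacent_def
  proof (intro allI impI notI, elim conjE bexE)
    fix us a b vs c d
    assume xs: "xs = us @ a # b # vs" and "a < b" "c \<in> set us" "b < c" "d \<in> set vs" "b < d"
    then obtain i k where "i < length us" "us ! i = c" "k < length vs" "vs ! k = d"
      by (auto simp: in_set_conv_nth)
    \<comment> \<open>In \<open>xs\<close>, the letters \<open>a\<close> and \<open>b\<close> occupy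
      positions \<open>length us\<close> and \<open>Suc (length us)\<close>, and \<open>vs\<close>
      starts at \<open>length us + 2\<close>.\<close>
    with xs \<open>a < b\<close> \<open>b < c\<close> \<open>b < d\<close>
    have "pogp_occurrence pattern_3_12_3 xs
        [i, length us, Suc (length us), length us + 2 + k]"
      unfolding pogp_occurrence_3_12_3_iff by (auto simp: nth_append)
    with * show False by (auto simp: avoids_pogp_def)
  qed
next
  assume *: "avoids_3_12_3 xs"
  show "avoids_pogp xs pattern_3_12_3"
    unfolding avoids_pogp_def pogp_occurrence_3_12_3_iff
  proof safe
    fix i j k
    assume less: "i < j" "Suc j < k" "k < length xs"
      and ord: "xs ! j < xs ! Suc j" "xs ! Suc j < xs ! i" "xs ! Suc j < xs ! k"
    \<comment> \<open>\<open>l\<close> is the position of \<open>xs ! k\<close> within the suffix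
      that follows the ascent.\<close>
    obtain l where l: "k = Suc (Suc j) + l"
      using le_Suc_ex[OF Suc_leI[OF less(2)]] by blast
    have "xs = take j xs @ xs ! j # xs ! Suc j # drop (Suc (Suc j)) xs"
      using less by (simp add: Cons_nth_drop_Suc)
    moreover have "xs ! i \<in> set (take j xs)"
      using less nth_mem[of i "take j xs"] by simp
    moreover have "xs ! k \<in> set (drop (Suc (Suc j)) xs)"
      using less(3) nth_mem[of l "drop (Suc (Suc j)) xs"] unfolding l by simp
    ultimately show False
      using * ord unfolding avoids_3_12_3_def all_adjacent_def by blast
  qed
qed

text \<open>The pairs that involve \<open>m\<close> are harmless: no letter exceeds \<open>m\<close>
  after an ascent into it, and a pair starting with \<open>m\<close> is a descent. For ascents
  elsewhere, \<open>m\<close> supplies a missing 3: a later one for \<open>xs\<close>, an earlier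
  one for \<open>ys\<close>. If that is the only outer letter of the pattern, the side can have no
  ascent at all and must be decreasing.\<close>

lemma avoids_append_max:
  fixes m :: "'a::linorder"
  assumes "\<And>x. x \<in> set xs \<union> set ys \<Longrightarrow> x < m"
  shows avoids_3_12_3_append_max:
      "avoids_3_12_3 (xs @ m # ys) \<longleftrightarrow> avoids_3_12 xs \<and> avoids_12_3 ys"
    and avoids_12_3_append_max:
      "avoids_12_3 (xs @ m # ys) \<longleftrightarrow> sorted_wrt (\<ge>) xs \<and> avoids_12_3 ys"
    and avoids_3_12_append_max:
      "avoids_3_12 (xs @ m # ys) \<longleftrightarrow> avoids_3_12 xs \<and> sorted_wrt (\<ge>) ys"
proof -
  \<comment> \<open>The predicates need to agree only on factorizations of the given word, since
    only its letters are known to lie below \<open>m\<close>.\<close>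
  have cong: "all_adjacent P zs \<longleftrightarrow> all_adjacent Q zs"
    if "\<And>us a b vs. zs = us @ a # b # vs \<Longrightarrow> P us a b vs \<longleftrightarrow> Q us a b vs" for P Q and zs :: "'a list"
    using that by (auto simp: all_adjacent_def)
  have less: "x < m" "\<not> m < x" if "x \<in> set xs \<or> x \<in> set ys" for x
    using assms that by (auto dest: order.asym)
  show "avoids_3_12_3 (xs @ m # ys) \<longleftrightarrow> avoids_3_12 xs \<and> avoids_12_3 ys"
  proof -
    have "all_adjacent (\<lambda>us a b vs. a < b \<longrightarrow>
            \<not> ((\<exists>c\<in>set us. b < c) \<and> (\<exists>d\<in>set (vs @ m # ys). b < d))) xs \<longleftrightarrow> avoids_3_12 xs"
      unfolding avoids_3_12_def by (rule cong) (use less in auto)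
    moreover have "all_adjacent (\<lambda>us a b vs. a < b \<longrightarrow>
            \<not> ((\<exists>c\<in>set (xs @ m # us). b < c) \<and> (\<exists>d\<in>set vs. b < d))) ys \<longleftrightarrow> avoids_12_3 ys"
      unfolding avoids_12_3_def by (rule cong) (use less in auto)
    ultimately show ?thesis
      using less unfolding avoids_3_12_3_def all_adjacent_append_Cons by auto
  qed
  show "avoids_12_3 (xs @ m # ys) \<longleftrightarrow> sorted_wrt (\<ge>) xs \<and> avoids_12_3 ys"
  proof -
    have "all_adjacent (\<lambda>us a b vs. a < b \<longrightarrow> \<not> (\<exists>d\<in>set (vs @ m # ys). b < d)) xs \<longleftrightarrow>
        sorted_wrt (\<ge>) xs"
      unfolding all_adjacent_not_less_iff[symmetric] by (rule cong) (use less in auto)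
    then show ?thesis
      using less unfolding avoids_12_3_def all_adjacent_append_Cons by auto
  qed
  show "avoids_3_12 (xs @ m # ys) \<longleftrightarrow> avoids_3_12 xs \<and> sorted_wrt (\<ge>) ys"
  proof -
    have "all_adjacent (\<lambda>us a b vs. a < b \<longrightarrow> \<not> (\<exists>c\<in>set (xs @ m # us). b < c)) ys \<longleftrightarrow>
        sorted_wrt (\<ge>) ys"
      unfolding all_adjacent_not_less_iff[symmetric] by (rule cong) (use less in auto)
    then show ?thesis
      using less unfolding avoids_3_12_def all_adjacent_append_Cons by auto
  qed
qed

section \<open>Splitting permutations at a letter\<close>

text \<open>As \<open>m\<close> occurs exactly once, it determines the words on both sides, and
  \<open>D\<close> is the set of letters to its left.\<close>

lemma bij_betw_permutations_of_set_split:
  assumes "m \<notin> S"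
  shows "bij_betw (\<lambda>(D, xs, ys). xs @ m # ys)
    (SIGMA D:Pow S. permutations_of_set D \<times> permutations_of_set (S - D))
    (permutations_of_set (insert m S))"
proof (rule bij_betw_imageI)
  show "inj_on (\<lambda>(D, xs, ys). xs @ m # ys)
    (SIGMA D:Pow S. permutations_of_set D \<times> permutations_of_set (S - D))"
  proof (rule inj_onI, clarsimp)
    fix D xs ys D' xs' ys'
    assume *: "D \<subseteq> S" "D' \<subseteq> S" "xs \<in> permutations_of_set D" "xs' \<in> permutations_of_set D'"
      "ys \<in> permutations_of_set (S - D)" "ys' \<in> permutations_of_set (S - D')"
      "xs @ m # ys = xs' @ m # ys'"
    then have "m \<notin> set xs" "m \<notin> set ys" "m \<notin> set xs'" "m \<notin> set ys'"
      using assms by (auto simp: permutations_of_set_def)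
    with *(7) have "xs = xs' \<and> ys = ys'"
      by (auto simp: append_Cons_eq_iff)
    with * show "D = D' \<and> xs = xs' \<and> ys = ys'"
      by (auto simp: permutations_of_set_def)
  qed
  show "(\<lambda>(D, xs, ys). xs @ m # ys) `
      (SIGMA D:Pow S. permutations_of_set D \<times> permutations_of_set (S - D)) =
      permutations_of_set (insert m S)" (is "?f ` ?A = _")
  proof
    show "?f ` ?A \<subseteq> permutations_of_set (insert m S)"
      using assms by (auto simp: permutations_of_set_def)
    show "permutations_of_set (insert m S) \<subseteq> ?f ` ?A"
    proof
      fix zs assume zs: "zs \<in> permutations_of_set (insert m S)"
      then have "m \<in> set zs" by (auto simp: permutations_of_set_def)
      then obtain xs ys where "zs = xs @ m # ys" by (auto simp: in_set_conv_decomp)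
      with zs assms show "zs \<in> ?f ` ?A"
        by (intro image_eqI[of _ _ "(set xs, xs, ys)"]) (auto simp: permutations_of_set_def)
    qed
  qed
qed

text \<open>The common source of the recursions for all three patterns: a property that factors at
  \<open>m\<close> restricts the splitting bijection to a product of independent choices for each
  \<open>D\<close>.\<close>

lemma card_permutations_of_set_split:
  assumes "finite S" "m \<notin> S"
    and "\<And>xs ys. set xs \<union> set ys = S \<Longrightarrow> Q (xs @ m # ys) \<longleftrightarrow> Q1 xs \<and> Q2 ys"
  shows "card {zs \<in> permutations_of_set (insert m S). Q zs} =
    (\<Sum>D\<in>Pow S. card {xs \<in> permutations_of_set D. Q1 xs} *
                card {ys \<in> permutations_of_set (S - D). Q2 ys})"
proof -
  let ?B = "SIGMA D:Pow S. {xs \<in> permutations_of_set D. Q1 xs} \<times>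
              {ys \<in> permutations_of_set (S - D). Q2 ys}"
  have bij: "bij_betw (\<lambda>(D, xs, ys). xs @ m # ys)
      {p \<in> SIGMA D:Pow S. permutations_of_set D \<times> permutations_of_set (S - D).
        (\<lambda>(D, xs, ys). Q1 xs \<and> Q2 ys) p}
      {zs \<in> permutations_of_set (insert m S). Q zs}"
    using assms(3)
    by (intro bij_betw_Collect bij_betw_permutations_of_set_split assms)
       (auto simp: permutations_of_set_def)
  have "card {zs \<in> permutations_of_set (insert m S). Q zs} = card ?B"
    using bij_betw_same_card[OF bij] by (rule trans[OF sym]) (rule arg_cong[of _ _ card], auto)
  also have "\<dots> = (\<Sum>D\<in>Pow S. card ({xs \<in> permutations_of_set D. Q1 xs} \<times>
              {ys \<in> permutations_of_set (S - D). Q2 ys}))"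
    using assms(1) by (intro card_SigmaI) (auto intro!: finite_cartesian_product)
  finally show ?thesis by (simp add: card_cartesian_product)
qed

text \<open>Reversal turns decreasing words into increasing ones, and the only increasing
  arrangement of \<open>D\<close> is \<open>sorted_list_of_set D\<close>.\<close>

lemma card_decreasing_permutations_of_set:
  fixes D :: "'a::linorder set"
  assumes "finite D"
  shows "card {xs \<in> permutations_of_set D. sorted_wrt (\<ge>) xs} = 1"
proof -
  have "{xs \<in> permutations_of_set D. sorted_wrt (\<ge>) xs} = {rev (sorted_list_of_set D)}"
  proof (intro equalityI subsetI; clarify)
    fix xs assume "xs \<in> permutations_of_set D" "sorted_wrt (\<ge>) xs"
    then have "sorted_list_of_set (set (rev xs)) = rev xs"
      by (intro sorted_list_of_set.idem_if_sorted_distinct)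
         (auto simp: permutations_of_set_def sorted_wrt_rev)
    then show "xs = rev (sorted_list_of_set D)"
      using \<open>xs \<in> permutations_of_set D\<close> by (simp add: permutations_of_set_def)
  next
    show "rev (sorted_list_of_set D) \<in> permutations_of_set D \<and>
        sorted_wrt (\<ge>) (rev (sorted_list_of_set D))"
      using assms by (auto simp: permutations_of_set_def sorted_wrt_rev)
  qed
  then show ?thesis by simp
qed

lemma sum_Pow_complement: "(\<Sum>D\<in>Pow S. f (S - D)) = (\<Sum>D\<in>Pow S. f D)"
  by (rule sum.reindex_bij_witness[of _ "\<lambda>D. S - D" "\<lambda>D. S - D"]) auto

section \<open>Set partitions by the block of a chosen element\<close>

text \<open>\<open>D\<close> collects the companions of \<open>m\<close> in its block and may be
  empty. Indexing by \<open>D\<close> instead of by the block makes the sum run over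
  \<open>Pow S\<close>, as in the splitting of permutations.\<close>

lemma bij_betw_partition_on_insert:
  assumes "m \<notin> S"
  shows "bij_betw (\<lambda>(D, P). insert (insert m D) P)
    (SIGMA D:Pow S. {P. partition_on (S - D) P}) {P. partition_on (insert m S) P}"
proof (rule bij_betw_imageI)
  let ?A = "SIGMA D:Pow S. {P. partition_on (S - D) P}"
  have m: "insert m S - insert m D = S - D" for D
    using assms by auto
  show "inj_on (\<lambda>(D, P). insert (insert m D) P) ?A"
  proof (rule inj_onI, clarsimp)
    fix D P D' P'
    assume *: "D \<subseteq> S" "partition_on (S - D) P" "D' \<subseteq> S" "partition_on (S - D') P'"
      "insert (insert m D) P = insert (insert m D') P'"
    \<comment> \<open>Since \<open>m\<close> lies in no block of \<open>P\<close> or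
      \<open>P'\<close>, the added block is recognizable as the one that contains
      \<open>m\<close>.\<close>
    have notin: "m \<notin> B" if "B \<in> P \<union> P'" for B
      using that partition_onD1[OF *(2)] partition_onD1[OF *(4)] assms by blast
    then have new: "insert m D \<notin> P \<union> P'" "insert m D' \<notin> P \<union> P'"
      by blast+
    have "insert m D \<in> insert (insert m D') P'"
      unfolding *(5)[symmetric] by simp
    with new have eq: "insert m D = insert m D'"
      by simp
    moreover have "m \<notin> D" "m \<notin> D'"
      using *(1,3) assms by auto
    ultimately have "D = D'"
      by (simp add: insert_ident)
    moreover have "P = P'"
      using *(5) new by (simp add: eq insert_ident)
    ultimately show "D = D' \<and> P = P'" ..
  qed
  show "(\<lambda>(D, P). insert (insert m D) P) ` ?A = {P. partition_on (insert m S) P}"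
  proof (intro equalityI subsetI; clarify)
    fix D P assume "D \<subseteq> S" "partition_on (S - D) P"
    moreover from this have "disjnt (insert m D) (\<Union> P)"
      using assms by (auto simp: disjnt_def partition_on_def)
    ultimately show "partition_on (insert m S) (insert (insert m D) P)"
      unfolding partition_on_insert[OF \<open>disjnt (insert m D) (\<Union> P)\<close>] m by auto
  next
    fix P assume P: "partition_on (insert m S) P"
    then obtain B where "m \<in> B" "B \<in> P"
      by (auto simp: partition_on_def)
    define D where "D = B - {m}"
    have B: "B = insert m D" using \<open>m \<in> B\<close> by (auto simp: D_def)
    have "B \<subseteq> insert m S" using P \<open>B \<in> P\<close> by (auto simp: partition_on_def)
    then have "D \<subseteq> S" by (auto simp: D_def)
    moreover have disj: "disjnt B (\<Union> (P - {B}))"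
      using partition_onD2[OF P] \<open>B \<in> P\<close> by (force simp: disjoint_def disjnt_def)
    have "insert B (P - {B}) = P"
      using \<open>B \<in> P\<close> by (rule insert_Diff)
    then have "partition_on (insert m S - B) (P - {B})"
      using P partition_on_insert[OF disj, of "insert m S"] by simp
    then have "partition_on (S - D) (P - {B})"
      by (simp only: B m)
    ultimately show "P \<in> (\<lambda>(D, P). insert (insert m D) P) ` ?A"
      using \<open>B \<in> P\<close> B by (intro image_eqI[of _ _ "(D, P - {B})"]) auto
  qed
qed

lemma card_partition_on_insert:
  assumes "finite S" "m \<notin> S"
  shows "card {P. partition_on (insert m S) P} = (\<Sum>D\<in>Pow S. card {P. partition_on (S - D) P})"
  using bij_betw_same_card[OF bij_betw_partition_on_insert[OF assms(2)], symmetric] assms(1)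
  by (simp add: finitely_many_partition_on)

section \<open>Counting the avoiders of 12-3 and 3-12\<close>

text \<open>Splitting at the maximum gives the recursion of set partitions. The induction runs over
  proper subsets because the remaining side may use any subset of the letters below the
  maximum.\<close>

lemma card_avoiders_eq_card_partition_on:
  fixes S :: "'a::linorder set"
  assumes "finite S"
  shows "card {xs \<in> permutations_of_set S. avoids_12_3 xs} = card {P. partition_on S P} \<and>
         card {xs \<in> permutations_of_set S. avoids_3_12 xs} = card {P. partition_on S P}"
  using assms
proof (induction S rule: finite_psubset_induct)
  case (psubset S)
  show ?case
  proof (cases "S = {}")
    case True
    have "{xs. xs = [] \<and> avoids_12_3 xs} = {[] :: 'a list}"
      "{xs. xs = [] \<and> avoids_3_12 xs} = {[] :: 'a list}"
      by (auto simp: avoids_12_3_def avoids_3_12_def all_adjacent_def)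
    with True show ?thesis
      by (simp add: partition_on_empty)
  next
    case False
    define m where "m = Max S"
    define T where "T = S - {m}"
    have "m \<in> S"
      unfolding m_def using psubset.hyps False by (rule Max_in)
    then have S: "S = insert m T" "m \<notin> T" "finite T"
      using psubset.hyps by (auto simp: T_def)
    have less: "x < m" if "x \<in> T" for x
      using psubset.hyps that by (auto simp: m_def T_def order.strict_iff_order)
    have IH: "card {xs \<in> permutations_of_set D. avoids_12_3 xs} = card {P. partition_on D P}"
      "card {xs \<in> permutations_of_set D. avoids_3_12 xs} = card {P. partition_on D P}"
      if "D \<subseteq> T" for D
      using psubset.IH[of D] that S by auto
    have dec: "card {xs \<in> permutations_of_set D. sorted_wrt (\<ge>) xs} = 1" if "D \<subseteq> T" for D
      using that S(3) by (intro card_decreasing_permutations_of_set) (rule finite_subset)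
    have "card {xs \<in> permutations_of_set S. avoids_12_3 xs} =
        (\<Sum>D\<in>Pow T. card {xs \<in> permutations_of_set D. sorted_wrt (\<ge>) xs} *
                    card {ys \<in> permutations_of_set (T - D). avoids_12_3 ys})"
      unfolding S(1) using S(2,3) less
      by (intro card_permutations_of_set_split avoids_12_3_append_max) auto
    \<comment> \<open>The decreasing side contributes the factor 1; the induction hypothesis applies
      to \<open>T - D\<close>, which lacks \<open>m\<close>.\<close>
    also have "\<dots> = (\<Sum>D\<in>Pow T. card {P. partition_on (T - D) P})"
      by (intro sum.cong) (auto simp: dec IH)
    also have "\<dots> = card {P. partition_on S P}"
      unfolding S(1) using S(2,3) by (simp add: card_partition_on_insert)
    finally have *: "card {xs \<in> permutations_of_set S. avoids_12_3 xs} = card {P. partition_on S P}" .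
    have "card {xs \<in> permutations_of_set S. avoids_3_12 xs} =
        (\<Sum>D\<in>Pow T. card {xs \<in> permutations_of_set D. avoids_3_12 xs} *
                    card {ys \<in> permutations_of_set (T - D). sorted_wrt (\<ge>) ys})"
      unfolding S(1) using S(2,3) less
      by (intro card_permutations_of_set_split avoids_3_12_append_max) auto
    also have "\<dots> = (\<Sum>D\<in>Pow T. card {P. partition_on D P})"
      by (intro sum.cong) (auto simp: dec IH)
    \<comment> \<open>Here the free side is the left one, with letters \<open>D\<close>;
      complementing in \<open>T\<close> gives the form of the partition recursion.\<close>
    also have "\<dots> = (\<Sum>D\<in>Pow T. card {P. partition_on (T - D) P})"
      by (rule sum_Pow_complement[symmetric])
    also have "\<dots> = card {P. partition_on S P}"
      unfolding S(1) using S(2,3) by (simp add: card_partition_on_insert)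
    finally show ?thesis using * by blast
  qed
qed

section \<open>Bicolored set partitions\<close>

text \<open>The blocks colored \<open>True\<close> partition the subset \<open>D\<close> that they
  cover, and those colored \<open>False\<close> partition its complement.\<close>

lemma bij_betw_bicolored_set_partitions:
  "bij_betw (\<lambda>(D, P, Q). (P \<union> Q, \<lambda>B\<in>P \<union> Q. B \<in> P))
    (SIGMA D:Pow S. {P. partition_on D P} \<times> {Q. partition_on (S - D) Q})
    (bicolored_set_partitions S)"
proof (rule bij_betw_byWitness[where f' = "\<lambda>(P, c).
    (\<Union> {B\<in>P. c B}, {B\<in>P. c B}, {B\<in>P. \<not> c B})"])
  \<comment> \<open>Blocks are nonempty, so none is contained in both \<open>D\<close> and
    \<open>S - D\<close>. Hence the color \<open>B \<in> P\<close> is \<open>False\<close> on every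
    block of \<open>Q\<close>, and the color classes give back \<open>P\<close> and
    \<open>Q\<close>.\<close>
  have disj: "B \<notin> Q" if "D \<subseteq> S" "partition_on D P" "partition_on (S - D) Q" "B \<in> P" for D P Q and B :: "'a set"
  proof
    assume "B \<in> Q"
    with that have "B \<subseteq> D" "B \<subseteq> S - D" "B \<noteq> {}"
      by (auto simp: partition_on_def)
    then show False by auto
  qed
  show "\<forall>p\<in>SIGMA D:Pow S. {P. partition_on D P} \<times> {Q. partition_on (S - D) Q}.
      (case case p of (D, P, Q) \<Rightarrow> (P \<union> Q, \<lambda>B\<in>P \<union> Q. B \<in> P) of
        (P, c) \<Rightarrow> (\<Union> {B\<in>P. c B}, {B\<in>P. c B}, {B\<in>P. \<not> c B})) = p"
  proof
    fix p assume "p \<in> (SIGMA D:Pow S. {P. partition_on D P} \<times> {Q. partition_on (S - D) Q})"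
    then obtain D P Q where p: "p = (D, P, Q)"
      and *: "D \<subseteq> S" "partition_on D P" "partition_on (S - D) Q"
      by auto
    have "{B \<in> P \<union> Q. (\<lambda>B\<in>P \<union> Q. B \<in> P) B} = P" "{B \<in> P \<union> Q. \<not> (\<lambda>B\<in>P \<union> Q. B \<in> P) B} = Q"
      using disj[OF *] by auto
    moreover have "\<Union> P = D" using * by (simp add: partition_on_def)
    ultimately show "(case case p of (D, P, Q) \<Rightarrow> (P \<union> Q, \<lambda>B\<in>P \<union> Q. B \<in> P) of
        (P, c) \<Rightarrow> (\<Union> {B\<in>P. c B}, {B\<in>P. c B}, {B\<in>P. \<not> c B})) = p"
      unfolding p prod.case by simp
  qed
  \<comment> \<open>Equality of the colorings off the blocks holds because both are
    \<open>undefined\<close> there.\<close>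
  show "\<forall>q\<in>bicolored_set_partitions S.
      (case case q of (P, c) \<Rightarrow> (\<Union> {B\<in>P. c B}, {B\<in>P. c B}, {B\<in>P. \<not> c B}) of
        (D, P, Q) \<Rightarrow> (P \<union> Q, \<lambda>B\<in>P \<union> Q. B \<in> P)) = q"
    by (auto simp: bicolored_set_partitions_def fun_eq_iff PiE_def extensional_def)
  show "(\<lambda>(D, P, Q). (P \<union> Q, \<lambda>B\<in>P \<union> Q. B \<in> P)) `
      (SIGMA D:Pow S. {P. partition_on D P} \<times> {Q. partition_on (S - D) Q})
      \<subseteq> bicolored_set_partitions S"
  proof (rule image_subsetI)
    fix p assume "p \<in> (SIGMA D:Pow S. {P. partition_on D P} \<times> {Q. partition_on (S - D) Q})"
    then obtain D P Q where p: "p = (D, P, Q)"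
      and *: "D \<subseteq> S" "partition_on D P" "partition_on (S - D) Q"
      by auto
    then have "\<Union> P = D" "\<Union> Q = S - D"
      by (simp_all add: partition_on_def)
    with * have "partition_on S (P \<union> Q)"
      unfolding partition_on_def by (auto intro!: disjoint_union)
    then show "(case p of (D, P, Q) \<Rightarrow> (P \<union> Q, \<lambda>B\<in>P \<union> Q. B \<in> P)) \<in> bicolored_set_partitions S"
      by (simp add: p bicolored_set_partitions_def)
  qed
  show "(\<lambda>(P, c). (\<Union> {B\<in>P. c B}, {B\<in>P. c B}, {B\<in>P. \<not> c B})) ` bicolored_set_partitions S
      \<subseteq> (SIGMA D:Pow S. {P. partition_on D P} \<times> {Q. partition_on (S - D) Q})"
  proof (rule image_subsetI)
    fix q assume "q \<in> bicolored_set_partitions S"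
    then obtain P c where q: "q = (P, c)" and P: "partition_on S P"
      by (auto simp: bicolored_set_partitions_def)
    \<comment> \<open>The blocks cover \<open>S\<close> and are pairwise disjoint, so what the
      \<open>True\<close> blocks miss is exactly what the \<open>False\<close> blocks cover.\<close>
    have "S - \<Union> {B\<in>P. c B} = \<Union> {B\<in>P. \<not> c B}"
      using P by (fastforce simp: partition_on_def disjoint_def)
    moreover have "\<Union> {B\<in>P. c B} \<subseteq> S" "partition_on (\<Union> {B\<in>P. c B}) {B\<in>P. c B}"
      "partition_on (\<Union> {B\<in>P. \<not> c B}) {B\<in>P. \<not> c B}"
      using P by (auto simp: partition_on_def disjoint_def)
    ultimately show "(case q of (P, c) \<Rightarrow> (\<Union> {B\<in>P. c B}, {B\<in>P. c B}, {B\<in>P. \<not> c B})) \<in>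
        (SIGMA D:Pow S. {P. partition_on D P} \<times> {Q. partition_on (S - D) Q})"
      by (simp add: q)
  qed
qed

text \<open>Finiteness matters as much as the count: \<open>card\<close> is 0 on infinite sets, so
  equal cardinalities give a bijection only between finite sets.\<close>

lemma bicolored_set_partitions_finite_card:
  assumes "finite S"
  shows finite_bicolored_set_partitions: "finite (bicolored_set_partitions S)"
    and card_bicolored_set_partitions: "card (bicolored_set_partitions S) =
      (\<Sum>D\<in>Pow S. card {P. partition_on D P} * card {Q. partition_on (S - D) Q})"
proof -
  have fin: "finite {P. partition_on D P}" "finite {Q. partition_on (S - D) Q}" if "D \<in> Pow S" for D
    using assms that finite_subset by (auto intro!: finitely_many_partition_on)
  with assms show "finite (bicolored_set_partitions S)"
    by (subst bij_betw_finite[OF bij_betw_bicolored_set_partitions, symmetric]) auto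
  show "card (bicolored_set_partitions S) =
      (\<Sum>D\<in>Pow S. card {P. partition_on D P} * card {Q. partition_on (S - D) Q})"
    using assms fin
    by (subst bij_betw_same_card[OF bij_betw_bicolored_set_partitions, symmetric])
       (simp add: card_cartesian_product)
qed

theorem corollary3:
  fixes n :: nat
  shows "\<exists>f. bij_betw f
           {\<pi> \<in> permutations_of_set {1..n + 1}. avoids_pogp \<pi> pattern_3_12_3}
           (bicolored_set_partitions {1..n})"
proof -
  \<comment> \<open>The maximum is \<open>Suc n\<close>, so the two sides share out exactly the
    letters \<open>{1..n}\<close>; this is the shift from permutations of n + 1 letters to
    partitions of n elements.\<close>
  have split: "avoids_3_12_3 (xs @ Suc n # ys) \<longleftrightarrow> avoids_3_12 xs \<and> avoids_12_3 ys"
    if "set xs \<union> set ys = {1..n}" for xs ys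
    using that by (intro avoids_3_12_3_append_max) auto
  have "card {\<pi> \<in> permutations_of_set {1..n + 1}. avoids_pogp \<pi> pattern_3_12_3} =
      card {\<pi> \<in> permutations_of_set (insert (Suc n) {1..n}). avoids_3_12_3 \<pi>}"
    by (simp add: avoids_pogp_3_12_3_iff atLeastAtMostSuc_conv)
  also have "\<dots> = (\<Sum>D\<in>Pow {1..n}. card {xs \<in> permutations_of_set D. avoids_3_12 xs} *
      card {ys \<in> permutations_of_set ({1..n} - D). avoids_12_3 ys})"
    by (intro card_permutations_of_set_split split) auto
  also have "\<dots> = (\<Sum>D\<in>Pow {1..n}. card {P. partition_on D P} *
      card {Q. partition_on ({1..n} - D) Q})"
    using finite_subset[of _ "{1..n}"]
    by (intro sum.cong refl) (simp add: card_avoiders_eq_card_partition_on)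
  also have "\<dots> = card (bicolored_set_partitions {1..n})"
    by (simp add: card_bicolored_set_partitions)
  \<comment> \<open>The bijection comes from equal finite cardinalities, not from an explicit
    map.\<close>
  finally show ?thesis
    by (intro finite_same_card_bij) (auto simp: finite_bicolored_set_partitions)
qed

end
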